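(* Let $a<b$ be real numbers, let $\gamma:[a,b]\to\mathbb{C}$ be an analytic curve, and let $N\geq 1$ be a natural number. For $t\in[a,b]$ set $$\Gamma(t)=\big(\gamma(t),\overline{\gamma(t)},\gamma'(t),\overline{\gamma'(t)},\ldots,\gamma^{(N)}(t),\overline{\gamma^{(N)}(t)}\big)\in\mathbb{C}^{2N+2},$$ and let $J=\Gamma([a,b])$. Let $\Omega\subset\mathbb{C}^{2N+2}$ be an open set containing $J$ and let $F:\Omega\to\mathbb{C}$ be a holomorphic map such that $F(J)\subset(0,+\infty)$. Define $$S(t)=\int_a^t F(\Gamma(u))\,du,\qquad t\in[a,b],$$ which is a strictly increasing continuous function from $[a,b]$ onto a compact interval $[A,B]\subset\mathbb{R}$, with inverse $S^{-1}:[A,B]\to[a,b]$. Then the curve $\delta=\gamma\circ S^{-1}:[A,B]\to\mathbb{C}$ is an analytic curve.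
   Context: Definition (analytic curve in $\mathbb{C}$). Let $I\subset\mathbb{R}$ be a nonempty interval of arbitrary type (open, closed, half-open, bounded or not) which is not a singleton. A continuous map $\gamma:I\to\mathbb{C}$ is an analytic curve if $\gamma$ is differentiable on $I$ with $\gamma'(t)\neq 0$ for all $t\in I$ (one-sided derivatives at endpoints belonging to $I$), and for every $t_0\in I$ there exist $\delta_{t_0}>0$ and a power series $\sum_{n=0}^\infty a_n(t-t_0)^n$ with $a_n\in\mathbb{C}$, convergent on $(t_0-\delta_{t_0},t_0+\delta_{t_0})$, such that $\gamma(t)=\sum_{n=0}^\infty a_n(t-t_0)^n$ for all $t\in I\cap(t_0-\delta_{t_0},t_0+\delta_{t_0})$. *)

theory Defs
  imports "HOL-Analysis.Analysis"
begin

definition analytic_curve :: "real set \<Rightarrow> (real \<Rightarrow> complex) \<Rightarrow> bool" where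
  "analytic_curve I \<gamma> \<longleftrightarrow>
     is_interval I \<and> I \<noteq> {} \<and> \<not> is_singleton I \<and>
     continuous_on I \<gamma> \<and>
     (\<forall>t\<in>I. \<gamma> differentiable (at t within I) \<and> vector_derivative \<gamma> (at t within I) \<noteq> 0) \<and>
     (\<forall>t\<^sub>0\<in>I. \<exists>d>0. \<exists>c :: nat \<Rightarrow> complex.
        (\<forall>t\<in>{t\<^sub>0 - d<..<t\<^sub>0 + d}. summable (\<lambda>n. c n * of_real (t - t\<^sub>0) ^ n)) \<and>
        (\<forall>t\<in>I \<inter> {t\<^sub>0 - d<..<t\<^sub>0 + d}. \<gamma> t = (\<Sum>n. c n * of_real (t - t\<^sub>0) ^ n)))"

text \<open>Iterated derivative of a curve relative to its domain \<open>I\<close>, hence one-sided at endpoints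
  belonging to \<open>I\<close>; only meaningful when \<open>I\<close> has no isolated points.\<close>

primrec nth_vector_derivative :: "nat \<Rightarrow> real set \<Rightarrow> (real \<Rightarrow> complex) \<Rightarrow> real \<Rightarrow> complex" where
  "nth_vector_derivative 0 I \<gamma> = \<gamma>"
| "nth_vector_derivative (Suc k) I \<gamma> =
     (\<lambda>t. vector_derivative (nth_vector_derivative k I \<gamma>) (at t within I))"

text \<open>The point \<open>(\<gamma>(t), cnj \<gamma>(t), \<gamma>'(t), cnj \<gamma>'(t), \<dots>)\<close>. The map \<open>e\<close> numbers the coordinates
  from \<open>0\<close>: position \<open>2k\<close> holds the \<open>k\<close>-th derivative and position \<open>2k + 1\<close> its conjugate.
  If \<open>e\<close> is a bijection onto \<open>{..<2 * N + 2}\<close>, exactly the orders \<open>k \<le> N\<close> occur.\<close>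

definition conj_jet ::
  "('m::finite \<Rightarrow> nat) \<Rightarrow> real set \<Rightarrow> (real \<Rightarrow> complex) \<Rightarrow> real \<Rightarrow> complex ^ 'm" where
  "conj_jet e I \<gamma> t =
     (\<chi> i. if even (e i) then nth_vector_derivative (e i div 2) I \<gamma> t
           else cnj (nth_vector_derivative (e i div 2) I \<gamma> t))"

text \<open>Holomorphy in several complex variables on an open set: at each point the function has a
  Frechet derivative which is complex-linear (real linearity is part of \<open>has_derivative\<close>).\<close>

definition holomorphic_several_on ::
  "(complex ^ 'm::finite \<Rightarrow> complex) \<Rightarrow> (complex ^ 'm) set \<Rightarrow> bool" where
  "holomorphic_several_on F \<Omega> \<longleftrightarrow>
     (\<forall>z\<in>\<Omega>. \<exists>L. (F has_derivative L) (at z) \<and> (\<forall>c v. L (c *s v) = c * L v))"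

end

theory Submission
  imports Defs "HOL-Complex_Analysis.Complex_Analysis"
begin

text \<open>
  Near each \<open>t\<^sub>0\<close> the curve is the restriction of a holomorphic function \<open>g\<close>. Its derivatives
  extend the derivatives of \<open>\<gamma>\<close>, and \<open>z \<mapsto> cnj (g\<^bsup>(k)\<^esup> (cnj z))\<close> extends their conjugates, so
  \<open>F \<circ> \<Gamma>\<close> extends to a holomorphic \<open>h\<close>. A primitive \<open>H\<close> of \<open>h\<close>, normalized at \<open>t\<^sub>0\<close>, extends \<open>S\<close>, and
  \<open>H'(t\<^sub>0) = F (\<Gamma> t\<^sub>0) \<noteq> 0\<close>. Hence \<open>H\<close> has a local holomorphic inverse \<open>K\<close>, and \<open>g \<circ> K\<close> extends
  \<open>\<gamma> \<circ> S\<^sup>-\<^sup>1\<close> near \<open>S t\<^sub>0\<close>.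
\<close>

section \<open>Real-analyticity at a point as local holomorphic extendability\<close>

text \<open>The extension \<open>g\<close> lives on a full disc, while agreement is demanded only at
  points of \<open>I\<close>. An endpoint of \<open>I\<close> is therefore treated like an interior
  point.\<close>

definition extends_holomorphically :: "real set \<Rightarrow> (real \<Rightarrow> complex) \<Rightarrow> real \<Rightarrow> bool" where
  "extends_holomorphically I \<gamma> t \<longleftrightarrow>
     (\<exists>r>0. \<exists>g. g holomorphic_on ball (of_real t) r \<and> (\<forall>u\<in>I \<inter> ball t r. \<gamma> u = g (of_real u)))"

lemma of_real_mem_ball_iff [simp]:
  "(of_real u :: 'a::real_normed_algebra_1) \<in> ball (of_real t) r \<longleftrightarrow> u \<in> ball t r"
  by (simp add: dist_norm flip: of_real_diff)

text \<open>Convergence on the real interval already forces convergence on the complex disc of the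
  same radius: for \<open>w\<close> in the disc, a real \<open>x\<close> is chosen with
  \<open>norm (w - of_real t\<^sub>0) < x < d\<close>, and convergence at
  \<open>of_real t\<^sub>0 + of_real x\<close> gives convergence at every point closer to the
  centre.\<close>

lemma power_series_extends_holomorphically:
  fixes c :: "nat \<Rightarrow> complex"
  assumes "d > 0"
    and summ: "\<forall>t\<in>{t\<^sub>0 - d<..<t\<^sub>0 + d}. summable (\<lambda>n. c n * of_real (t - t\<^sub>0) ^ n)"
    and eq: "\<forall>t\<in>I \<inter> {t\<^sub>0 - d<..<t\<^sub>0 + d}. \<gamma> t = (\<Sum>n. c n * of_real (t - t\<^sub>0) ^ n)"
  shows "extends_holomorphically I \<gamma> t\<^sub>0"
proof -
  have "(\<lambda>n. c n * (w - of_real t\<^sub>0) ^ n) sums (\<Sum>n. c n * (w - of_real t\<^sub>0) ^ n)"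
    if w: "w \<in> ball (of_real t\<^sub>0) d" for w :: complex
  proof -
    obtain x where x: "norm (w - of_real t\<^sub>0) < x" "x < d"
      using w dense[of "norm (w - of_real t\<^sub>0)" d] by (auto simp: dist_norm norm_minus_commute)
    have "x > 0"
      using x(1) by (meson le_less_trans norm_ge_zero)
    then have "summable (\<lambda>n. c n * of_real x ^ n)"
      using bspec[OF summ, of "t\<^sub>0 + x"] x by simp
    with x \<open>x > 0\<close> show ?thesis
      by (intro summable_sums) (rule powser_inside, auto)
  qed
  then have "(\<lambda>w. \<Sum>n. c n * (w - of_real t\<^sub>0) ^ n) holomorphic_on ball (of_real t\<^sub>0) d"
    by (rule power_series_holomorphic)
  with \<open>d > 0\<close> eq show ?thesis
    unfolding extends_holomorphically_def
    by (intro exI[of _ d] conjI exI[of _ "\<lambda>w. \<Sum>n. c n * (w - of_real t\<^sub>0) ^ n"])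
       (auto simp: dist_real_def abs_less_iff)
qed

lemma extends_holomorphically_power_series:
  assumes "extends_holomorphically I \<gamma> t\<^sub>0"
  shows "\<exists>d>0. \<exists>c :: nat \<Rightarrow> complex.
        (\<forall>t\<in>{t\<^sub>0 - d<..<t\<^sub>0 + d}. summable (\<lambda>n. c n * of_real (t - t\<^sub>0) ^ n)) \<and>
        (\<forall>t\<in>I \<inter> {t\<^sub>0 - d<..<t\<^sub>0 + d}. \<gamma> t = (\<Sum>n. c n * of_real (t - t\<^sub>0) ^ n))"
proof -
  obtain r g where r: "r > 0" and g: "g holomorphic_on ball (of_real t\<^sub>0) r"
    and eq: "\<And>u. u \<in> I \<inter> ball t\<^sub>0 r \<Longrightarrow> \<gamma> u = g (of_real u)"
    using assms unfolding extends_holomorphically_def by blast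
  define c where "c n = (deriv ^^ n) g (of_real t\<^sub>0) / fact n" for n
  have sums: "(\<lambda>n. c n * of_real (t - t\<^sub>0) ^ n) sums g (of_real t)" if "t \<in> {t\<^sub>0 - r<..<t\<^sub>0 + r}" for t
    using holomorphic_power_series[OF g, of "of_real t"] that
    by (simp add: c_def dist_real_def abs_less_iff)
  then show ?thesis
    using r eq sums_summable[OF sums] sums_unique[OF sums]
    by (intro exI[of _ r] conjI exI[of _ c]) (auto simp: dist_real_def abs_less_iff)
qed

lemma extends_holomorphically_iff_power_series:
  "extends_holomorphically I \<gamma> t\<^sub>0 \<longleftrightarrow> (\<exists>d>0. \<exists>c :: nat \<Rightarrow> complex.
        (\<forall>t\<in>{t\<^sub>0 - d<..<t\<^sub>0 + d}. summable (\<lambda>n. c n * of_real (t - t\<^sub>0) ^ n)) \<and>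
        (\<forall>t\<in>I \<inter> {t\<^sub>0 - d<..<t\<^sub>0 + d}. \<gamma> t = (\<Sum>n. c n * of_real (t - t\<^sub>0) ^ n)))"
  by (rule iffI, erule extends_holomorphically_power_series, elim exE conjE)
     (rule power_series_extends_holomorphically)

text \<open>Replaces the power series clause by holomorphic extendability, which is stable under
  differentiation, composition and inversion without any manipulation of coefficients.\<close>

lemma analytic_curve_alt_def:
  "analytic_curve I \<gamma> \<longleftrightarrow>
     is_interval I \<and> I \<noteq> {} \<and> \<not> is_singleton I \<and> continuous_on I \<gamma> \<and>
     (\<forall>t\<in>I. \<gamma> differentiable (at t within I) \<and> vector_derivative \<gamma> (at t within I) \<noteq> 0) \<and>
     (\<forall>t\<in>I. extends_holomorphically I \<gamma> t)"
  by (simp only: analytic_curve_def extends_holomorphically_iff_power_series)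

section \<open>Holomorphic extension of the jet and of its image under \<open>F\<close>\<close>

text \<open>Restricting a complex derivative to the real line gives a vector derivative, and
  \<open>a < b\<close> makes the derivative within \<open>{a..b}\<close> unique, also at the
  endpoints. Induction on \<open>k\<close> then identifies the iterated derivatives.\<close>

lemma nth_vector_derivative_eq_higher_deriv:
  assumes "a < b" and g: "g holomorphic_on ball (of_real t\<^sub>0) r"
    and eq: "\<And>u. u \<in> {a..b} \<inter> ball t\<^sub>0 r \<Longrightarrow> \<gamma> u = g (of_real u)"
    and t: "t \<in> {a..b} \<inter> ball t\<^sub>0 r"
  shows "nth_vector_derivative k {a..b} \<gamma> t = (deriv ^^ k) g (of_real t)"
  using t
proof (induction k arbitrary: t)
  case 0
  then show ?case using eq by simp
next
  case (Suc k)
  \<comment> \<open>Differentiating once more requires the induction hypothesis on a whole relative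
    neighbourhood of \<open>t\<close>, not only at \<open>t\<close>.\<close>
  obtain \<epsilon> where \<epsilon>: "\<epsilon> > 0" "ball t \<epsilon> \<subseteq> ball t\<^sub>0 r"
    using openE[OF open_ball IntD2[OF Suc.prems]] .
  have "((deriv ^^ k) g has_field_derivative (deriv ^^ Suc k) g (of_real t)) (at (of_real t))"
    using holomorphic_derivI[OF holomorphic_higher_deriv[OF g open_ball] open_ball, of "of_real t" k]
      Suc.prems by simp
  then have "((\<lambda>u. (deriv ^^ k) g (of_real u)) has_vector_derivative (deriv ^^ Suc k) g (of_real t))
      (at t within {a..b})"
    by (rule has_vector_derivative_real_field)
  then have "(nth_vector_derivative k {a..b} \<gamma> has_vector_derivative (deriv ^^ Suc k) g (of_real t))
      (at t within {a..b})"
  proof (rule has_vector_derivative_transform_within[OF _ \<open>\<epsilon> > 0\<close>])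
    fix u assume u: "u \<in> {a..b}" "dist u t < \<epsilon>"
    then have "u \<in> ball t \<epsilon>"
      by (simp add: dist_commute)
    with u \<epsilon>(2) have "u \<in> {a..b} \<inter> ball t\<^sub>0 r"
      by blast
    then show "(deriv ^^ k) g (of_real u) = nth_vector_derivative k {a..b} \<gamma> u"
      by (rule Suc.IH[symmetric])
  qed (use Suc.prems in simp)
  then have "vector_derivative (nth_vector_derivative k {a..b} \<gamma>) (at t within {a..b})
      = (deriv ^^ Suc k) g (of_real t)"
    by (rule vector_derivative_within_closed_interval[OF \<open>a < b\<close> IntD1[OF Suc.prems]])
  then show ?case
    by (simp only: nth_vector_derivative.simps)
qed

text \<open>The derivative of \<open>G\<close> is \<open>h *s D\<close>, with \<open>D\<close> the
  vector of coordinate derivatives. Complex linearity of \<open>L\<close> turns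
  \<open>L (h *s D)\<close> into \<open>h * L D\<close>, so the composite has complex derivative
  \<open>L D\<close>.\<close>

lemma holomorphic_several_compose:
  fixes G :: "complex \<Rightarrow> complex ^ 'm::finite"
  assumes F: "holomorphic_several_on F \<Omega>" and "open U"
    and G: "\<And>i. (\<lambda>z. G z $ i) holomorphic_on U" and "G ` U \<subseteq> \<Omega>"
  shows "(\<lambda>z. F (G z)) holomorphic_on U"
proof -
  have "\<exists>D. ((\<lambda>z. F (G z)) has_field_derivative D) (at z)" if z: "z \<in> U" for z
  proof -
    define D where "D = (\<chi> i. deriv (\<lambda>z. G z $ i) z)"
    obtain L where L: "(F has_derivative L) (at (G z))" "\<And>c v. L (c *s v) = c * L v"
      using F \<open>G ` U \<subseteq> \<Omega>\<close> z unfolding holomorphic_several_on_def by blast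
    have "((\<lambda>z. G z $ i) has_derivative (\<lambda>h. (h *s D) $ i)) (at z)" for i
      using holomorphic_derivI[OF G \<open>open U\<close> z, of i]
      by (simp add: D_def has_field_derivative_def mult.commute[of _ "deriv _ _"])
    then have "(G has_derivative (\<lambda>h. h *s D)) (at z)"
      by (subst has_derivative_componentwise_within)
         (auto simp: Basis_vec_def inner_axis intro!: has_derivative_inner_left)
    then have "((\<lambda>z. F (G z)) has_derivative (\<lambda>h. L (h *s D))) (at z)"
      using L(1) by (rule has_derivative_compose)
    then show ?thesis
      by (auto simp: L(2) has_field_derivative_def mult.commute[of _ "L D"])
  qed
  then show ?thesis
    using \<open>open U\<close> by (simp add: holomorphic_on_open)
qed

lemma extends_holomorphically_jet_functional:
  assumes "a < b" and ext: "extends_holomorphically {a..b} \<gamma> t\<^sub>0" and t0: "t\<^sub>0 \<in> {a..b}"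
    and \<Omega>: "open \<Omega>" "conj_jet e {a..b} \<gamma> ` {a..b} \<subseteq> \<Omega>"
    and F: "holomorphic_several_on F \<Omega>"
  shows "extends_holomorphically {a..b} (\<lambda>t. F (conj_jet e {a..b} \<gamma> t)) t\<^sub>0"
proof -
  obtain r g where r: "r > 0" and g: "g holomorphic_on ball (of_real t\<^sub>0) r"
    and eq: "\<And>u. u \<in> {a..b} \<inter> ball t\<^sub>0 r \<Longrightarrow> \<gamma> u = g (of_real u)"
    using ext unfolding extends_holomorphically_def by blast
  define G where "G z = (\<chi> i. if even (e i) then (deriv ^^ (e i div 2)) g z
      else cnj ((deriv ^^ (e i div 2)) g (cnj z)))" for z
  have jet: "conj_jet e {a..b} \<gamma> t = G (of_real t)" if "t \<in> {a..b} \<inter> ball t\<^sub>0 r" for t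
    using nth_vector_derivative_eq_higher_deriv[OF \<open>a < b\<close> g eq that]
    by (simp add: conj_jet_def G_def vec_eq_iff)
  \<comment> \<open>The centre is real, so the disc is symmetric about the real axis and
    \<open>g\<close> is defined at \<open>cnj z\<close>. On the real axis the inner conjugation
    disappears, leaving the conjugate coordinates of the jet.\<close>
  have cnj_ball: "cnj ` ball (of_real t\<^sub>0) r = ball (of_real t\<^sub>0) r"
  proof -
    have "dist (of_real t\<^sub>0) (cnj z) = dist (of_real t\<^sub>0) z" for z
      by (metis complex_cnj_complex_of_real complex_cnj_diff complex_mod_cnj dist_norm)
    then show ?thesis
      by (force intro: image_eqI[of _ cnj "cnj _"])
  qed
  have Gi: "(\<lambda>z. G z $ i) holomorphic_on ball (of_real t\<^sub>0) r" for i
  proof (cases "even (e i)")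
    case True
    then show ?thesis by (simp add: G_def holomorphic_higher_deriv g)
  next
    case False
    have "(deriv ^^ (e i div 2)) g holomorphic_on cnj ` ball (of_real t\<^sub>0) r"
      unfolding cnj_ball by (simp add: holomorphic_higher_deriv g)
    then have "cnj \<circ> (deriv ^^ (e i div 2)) g \<circ> cnj holomorphic_on ball (of_real t\<^sub>0) r"
      by (intro holomorphic_on_compose_cnj_cnj) auto
    with False show ?thesis by (simp add: G_def o_def)
  qed
  have "continuous_on (ball (of_real t\<^sub>0) r) G"
    by (subst continuous_on_componentwise)
       (auto simp: Basis_vec_def inner_axis
         intro!: continuous_intros holomorphic_on_imp_continuous_on[OF Gi])
  \<comment> \<open>Only real points of \<open>{a..b}\<close> are known to be sent into \<Omega>.
    Continuity of \<open>G\<close> provides a smaller disc whose image stays inside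
    \<Omega>.\<close>
  then have "open (ball (of_real t\<^sub>0) r \<inter> G -` \<Omega>)"
    using \<Omega>(1) by (simp add: continuous_open_preimage)
  moreover have "of_real t\<^sub>0 \<in> ball (of_real t\<^sub>0) r \<inter> G -` \<Omega>"
    using \<Omega>(2) jet[of t\<^sub>0] r t0 by force
  ultimately obtain \<rho> where \<rho>: "\<rho> > 0" "ball (of_real t\<^sub>0) \<rho> \<subseteq> ball (of_real t\<^sub>0) r \<inter> G -` \<Omega>"
    unfolding open_contains_ball by blast
  have "(\<lambda>z. F (G z)) holomorphic_on ball (of_real t\<^sub>0) \<rho>"
    using \<rho>(2) by (intro holomorphic_several_compose[OF F] holomorphic_on_subset[OF Gi]) auto
  moreover have "F (conj_jet e {a..b} \<gamma> u) = F (G (of_real u))" if "u \<in> {a..b} \<inter> ball t\<^sub>0 \<rho>" for u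
  proof -
    have "(of_real u :: complex) \<in> ball (of_real t\<^sub>0) \<rho>"
      using that by (subst of_real_mem_ball_iff) blast
    then have "(of_real u :: complex) \<in> ball (of_real t\<^sub>0) r"
      using \<rho>(2) by blast
    then have "u \<in> ball t\<^sub>0 r"
      by (subst (asm) of_real_mem_ball_iff)
    then show ?thesis
      using that jet by simp
  qed
  ultimately show ?thesis
    using \<rho>(1) unfolding extends_holomorphically_def by blast
qed

section \<open>Continuity, primitives and local inverses\<close>

lemma extends_holomorphically_imp_continuous:
  assumes "extends_holomorphically I \<gamma> t" and "t \<in> I"
  shows "continuous (at t within I) \<gamma>"
proof -
  obtain r g where r: "r > 0" and g: "g holomorphic_on ball (of_real t) r"
    and eq: "\<And>u. u \<in> I \<inter> ball t r \<Longrightarrow> \<gamma> u = g (of_real u)"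
    using assms unfolding extends_holomorphically_def by blast
  have "isCont g (of_real t)"
    using holomorphic_on_imp_continuous_on[OF g] r by (simp add: continuous_on_eq_continuous_at)
  then have "continuous (at t within I) (\<lambda>u. g (of_real u))"
    by (rule continuous_within_compose3) (rule continuous_of_real[OF continuous_ident])
  then show ?thesis
  proof (rule continuous_transform_within[OF _ r \<open>t \<in> I\<close>])
    fix u assume "u \<in> I" "dist u t < r"
    then show "g (of_real u) = \<gamma> u"
      by (intro eq[symmetric]) (simp add: dist_commute)
  qed
qed

lemma holomorphic_antiderivative_extends:
  assumes "convex I" and "t\<^sub>0 \<in> I" and r: "r > 0" and h: "h holomorphic_on ball (of_real t\<^sub>0) r"
    and \<sigma>: "\<And>t. t \<in> I \<inter> ball t\<^sub>0 r \<Longrightarrow> (\<sigma> has_vector_derivative h (of_real t)) (at t within I)"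
  obtains H where "\<And>z. z \<in> ball (of_real t\<^sub>0) r \<Longrightarrow> (H has_field_derivative h z) (at z)"
    "\<And>t. t \<in> I \<inter> ball t\<^sub>0 r \<Longrightarrow> \<sigma> t = H (of_real t)"
proof -
  obtain H where H: "\<And>z. z \<in> ball (of_real t\<^sub>0) r \<Longrightarrow> (H has_field_derivative h z) (at z)"
    using holomorphic_convex_primitive'[OF convex_ball open_ball h]
    by (metis at_within_open open_ball)
  \<comment> \<open>The additive constant makes \<open>K\<close> agree with \<sigma> at
    \<open>t\<^sub>0\<close>. Agreement on the rest of the convex set
    \<open>I \<inter> ball t\<^sub>0 r\<close> follows because the difference of \<sigma> and
    \<open>H\<close> has zero derivative there.\<close>
  define K where "K z = H z + (\<sigma> t\<^sub>0 - H (of_real t\<^sub>0))" for z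
  have "\<sigma> t - H (of_real t) = \<sigma> t\<^sub>0 - H (of_real t\<^sub>0)" if t: "t \<in> I \<inter> ball t\<^sub>0 r" for t
  proof (rule has_derivative_zero_unique[where s = "I \<inter> ball t\<^sub>0 r"])
    fix u assume u: "u \<in> I \<inter> ball t\<^sub>0 r"
    have "((\<lambda>t. \<sigma> t - H (of_real t)) has_vector_derivative h (of_real u) - h (of_real u))
        (at u within I \<inter> ball t\<^sub>0 r)"
      using u by (intro has_vector_derivative_diff has_vector_derivative_real_field H
          has_vector_derivative_within_subset[OF \<sigma>]) (auto simp del: mem_ball)
    then show "((\<lambda>t. \<sigma> t - H (of_real t)) has_derivative (\<lambda>h. 0)) (at u within I \<inter> ball t\<^sub>0 r)"
      by (simp add: has_vector_derivative_def)
  qed (use assms t in \<open>auto intro: convex_Int\<close>)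
  then show ?thesis
    by (intro that[of K]) (auto simp: K_def[abs_def] algebra_simps intro!: derivative_eq_intros H)
qed

text \<open>A nonzero derivative gives injectivity on a small disc, an injective holomorphic map has
  a holomorphic inverse on its image, and the open mapping theorem places a disc around
  \<open>H z\<^sub>0\<close> in that image.\<close>

lemma locally_holomorphic_inverse:
  assumes h: "H holomorphic_on U" and U: "open U" "z\<^sub>0 \<in> U" and dnz: "deriv H z\<^sub>0 \<noteq> 0"
  obtains r \<rho> K where "r > 0" "\<rho> > 0" "ball z\<^sub>0 r \<subseteq> U"
    "K holomorphic_on ball (H z\<^sub>0) \<rho>" "K ` ball (H z\<^sub>0) \<rho> \<subseteq> ball z\<^sub>0 r"
    "\<And>z. z \<in> ball z\<^sub>0 r \<Longrightarrow> K (H z) = z"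
proof -
  obtain r where r: "r > 0" "ball z\<^sub>0 r \<subseteq> U" "inj_on H (ball z\<^sub>0 r)"
    using has_complex_derivative_locally_injective[OF h U(2,1) dnz] .
  have hr: "H holomorphic_on ball z\<^sub>0 r"
    using h r(2) by (rule holomorphic_on_subset)
  obtain K where K: "K holomorphic_on H ` ball z\<^sub>0 r" "\<And>z. z \<in> ball z\<^sub>0 r \<Longrightarrow> K (H z) = z"
    using holomorphic_has_inverse[OF hr open_ball r(3)] by metis
  have "open (H ` ball z\<^sub>0 r)"
    using open_mapping_thm3[OF hr open_ball r(3)] .
  then obtain \<rho> where \<rho>: "\<rho> > 0" "ball (H z\<^sub>0) \<rho> \<subseteq> H ` ball z\<^sub>0 r"
    using r(1) unfolding open_contains_ball by (metis centre_in_ball imageI)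
  show ?thesis
    using r \<rho> K by (intro that[of r \<rho> K]) (auto intro: holomorphic_on_subset)
qed

text \<open>Since \<open>H\<close> extends \<open>S\<close>, its local inverse \<open>K\<close>
  extends the inverse of \<open>S\<close>, and \<open>g \<circ> K\<close> extends the reparametrized
  curve.\<close>

lemma extends_holomorphically_reparametrize:
  assumes S: "inj_on S {a..b}" "continuous_on {a..b} S" and t0: "t\<^sub>0 \<in> {a..b}"
    and \<gamma>: "extends_holomorphically {a..b} \<gamma> t\<^sub>0"
    and H: "H holomorphic_on ball (of_real t\<^sub>0) R" "R > 0" "deriv H (of_real t\<^sub>0) \<noteq> 0"
      "\<And>t. t \<in> {a..b} \<inter> ball t\<^sub>0 R \<Longrightarrow> of_real (S t) = H (of_real t)"
  shows "extends_holomorphically (S ` {a..b}) (\<gamma> \<circ> the_inv_into {a..b} S) (S t\<^sub>0)"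
proof -
  obtain r1 g where r1: "r1 > 0" and g: "g holomorphic_on ball (of_real t\<^sub>0) r1"
    and eq: "\<And>u. u \<in> {a..b} \<inter> ball t\<^sub>0 r1 \<Longrightarrow> \<gamma> u = g (of_real u)"
    using \<gamma> unfolding extends_holomorphically_def by blast
  \<comment> \<open>The minimum with \<open>r1\<close> keeps the values of \<open>K\<close> in the
    disc where \<open>g\<close> is holomorphic.\<close>
  have Hmin: "H holomorphic_on ball (of_real t\<^sub>0) (min R r1)"
    using H(1) by (rule holomorphic_on_subset) auto
  obtain r \<rho> K where r: "r > 0" "\<rho> > 0" "ball (of_real t\<^sub>0) r \<subseteq> ball (of_real t\<^sub>0 :: complex) (min R r1)"
    and K: "K holomorphic_on ball (H (of_real t\<^sub>0)) \<rho>" "K ` ball (H (of_real t\<^sub>0)) \<rho> \<subseteq> ball (of_real t\<^sub>0) r"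
      "\<And>z. z \<in> ball (of_real t\<^sub>0) r \<Longrightarrow> K (H z) = z"
    using locally_holomorphic_inverse[OF Hmin open_ball _ H(3)] r1 \<open>R > 0\<close> by auto
  have Ht0: "H (of_real t\<^sub>0) = of_real (S t\<^sub>0)"
    using H(4)[of t\<^sub>0] t0 \<open>R > 0\<close> by simp
  have sub: "ball t\<^sub>0 r \<subseteq> ball t\<^sub>0 (min R r1)"
    using r(3) by (metis of_real_mem_ball_iff subset_eq)
  let ?T = "the_inv_into {a..b} S"
  \<comment> \<open>The identity \<open>K (H z) = z\<close> is available only near
    \<open>t\<^sub>0\<close>. Continuity of the inverse, from compactness of \<open>{a..b}\<close>,
    ensures that parameters near \<open>S t\<^sub>0\<close> come from points within \<open>r\<close>
    of \<open>t\<^sub>0\<close>.\<close>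
  have "continuous_on (S ` {a..b}) ?T"
    by (intro continuous_on_inv_into S compact_Icc)
  then obtain \<eta> where \<eta>: "\<eta> > 0"
    "\<And>s. s \<in> S ` {a..b} \<Longrightarrow> dist s (S t\<^sub>0) < \<eta> \<Longrightarrow> dist (?T s) (?T (S t\<^sub>0)) < r"
    using \<open>r > 0\<close> t0 unfolding continuous_on_iff by (metis imageI)
  have T: "?T (S t) = t" if "t \<in> {a..b}" for t
    using the_inv_into_f_f[OF S(1) that] .
  have "(g \<circ> K) holomorphic_on ball (of_real (S t\<^sub>0)) (min \<eta> \<rho>)"
  proof (rule holomorphic_on_compose)
    show "K holomorphic_on ball (of_real (S t\<^sub>0)) (min \<eta> \<rho>)"
      using K(1) by (rule holomorphic_on_subset) (auto simp: Ht0)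
    show "g holomorphic_on K ` ball (of_real (S t\<^sub>0)) (min \<eta> \<rho>)"
    proof (rule holomorphic_on_subset[OF g])
      have "K ` ball (of_real (S t\<^sub>0)) (min \<eta> \<rho>) \<subseteq> K ` ball (H (of_real t\<^sub>0)) \<rho>"
        by (auto simp: Ht0)
      also have "\<dots> \<subseteq> ball (of_real t\<^sub>0) (min R r1)"
        using K(2) r(3) by (rule order_trans)
      also have "\<dots> \<subseteq> ball (of_real t\<^sub>0) r1"
        by auto
      finally show "K ` ball (of_real (S t\<^sub>0)) (min \<eta> \<rho>) \<subseteq> ball (of_real t\<^sub>0) r1" .
    qed
  qed
  moreover have "(\<gamma> \<circ> ?T) s = (g \<circ> K) (of_real s)"
    if s: "s \<in> S ` {a..b} \<inter> ball (S t\<^sub>0) (min \<eta> \<rho>)" for s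
  proof -
    obtain t where t: "t \<in> {a..b}" "s = S t"
      using s by blast
    then have tr: "t \<in> ball t\<^sub>0 r"
      using \<eta>(2)[of s] s t0 T by (auto simp: dist_commute)
    then have "K (of_real s) = of_real t"
      using K(3)[of "of_real t"] H(4)[of t] t sub
      by (metis IntI of_real_mem_ball_iff mem_ball min_less_iff_conj subset_eq)
    with t tr show ?thesis
      using eq[of t] sub T by auto
  qed
  ultimately show ?thesis
    using \<eta>(1) r(2) unfolding extends_holomorphically_def
    by (intro exI[of _ "min \<eta> \<rho>"] conjI exI[of _ "g \<circ> K"]) auto
qed

text \<open>The difference quotient of the inverse at \<open>s\<close> is the reciprocal of that of
  \<open>S\<close> at \<open>?T s\<close>. Working within the sets covers the one-sided derivatives
  at the endpoints.\<close>

lemma has_real_derivative_the_inv_into: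
  fixes S :: "real \<Rightarrow> real"
  assumes S: "inj_on S {a..b}" "continuous_on {a..b} S" and t: "t \<in> {a..b}"
    and dS: "(S has_real_derivative D) (at t within {a..b})" "D \<noteq> 0"
  shows "(the_inv_into {a..b} S has_real_derivative inverse D) (at (S t) within S ` {a..b})"
proof -
  let ?T = "the_inv_into {a..b} S"
  have T: "?T (S u) = u" if "u \<in> {a..b}" for u
    using the_inv_into_f_f[OF S(1) that] .
  have "continuous_on (S ` {a..b}) ?T"
    by (intro continuous_on_inv_into S compact_Icc)
  then have lim: "(?T \<longlongrightarrow> t) (at (S t) within S ` {a..b})"
    using t T by (metis continuous_on imageI)
  \<comment> \<open>Away from \<open>S t\<close> the inverse avoids \<open>t\<close>, so it tends to
    \<open>t\<close> through the punctured neighbourhoods in which the limit of the quotient of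
    \<open>S\<close> is taken.\<close>
  have "eventually (\<lambda>s. s \<in> S ` {a..b} \<and> s \<noteq> S t) (at (S t) within S ` {a..b})"
    by (simp add: eventually_at_filter)
  then have ev: "eventually (\<lambda>s. ?T s \<in> {a..b} \<and> ?T s \<noteq> t \<and> S (?T s) = s) (at (S t) within S ` {a..b})"
    by eventually_elim (use T in auto)
  have "filterlim ?T (at t within {a..b}) (at (S t) within S ` {a..b})"
    using lim by (auto simp: filterlim_at intro: eventually_mono[OF ev])
  moreover have "((\<lambda>u. inverse ((S u - S t) / (u - t))) \<longlongrightarrow> inverse D) (at t within {a..b})"
    using dS by (intro tendsto_inverse) (auto simp: has_field_derivative_iff)
  ultimately have "((\<lambda>s. inverse ((S (?T s) - S t) / (?T s - t))) \<longlongrightarrow> inverse D) (at (S t) within S ` {a..b})"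
    by (rule filterlim_compose[rotated])
  moreover have "eventually (\<lambda>s. inverse ((S (?T s) - S t) / (?T s - t)) = (?T s - ?T (S t)) / (s - S t))
      (at (S t) within S ` {a..b})"
    using ev by eventually_elim (use T t in \<open>auto simp: field_simps\<close>)
  ultimately show ?thesis
    unfolding has_field_derivative_iff by (rule Lim_transform_eventually)
qed

section \<open>The integral parameter and the reparametrized curve\<close>

theorem theorem2p2:
  fixes a b :: real and \<gamma> :: "real \<Rightarrow> complex" and N :: nat
    and e :: "'m::finite \<Rightarrow> nat"
    and \<Omega> :: "(complex ^ 'm) set" and F :: "complex ^ 'm \<Rightarrow> complex"
    and \<Gamma> :: "real \<Rightarrow> complex ^ 'm" and S :: "real \<Rightarrow> real"
  assumes "a < b"
    and "analytic_curve {a..b} \<gamma>"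
    and "N \<ge> 1"
    and "bij_betw e UNIV {..<2 * N + 2}"
    and "\<And>t. t \<in> {a..b} \<Longrightarrow> \<Gamma> t = conj_jet e {a..b} \<gamma> t"
    and "open \<Omega>" and "\<Gamma> ` {a..b} \<subseteq> \<Omega>"
    and "holomorphic_several_on F \<Omega>"
    and "F ` (\<Gamma> ` {a..b}) \<subseteq> complex_of_real ` {0<..}"
    and "\<And>t. t \<in> {a..b} \<Longrightarrow> S t = integral {a..t} (\<lambda>u. Re (F (\<Gamma> u)))"
  shows "strict_mono_on {a..b} S \<and> continuous_on {a..b} S \<and>
    (\<exists>A B. S ` {a..b} = {A..B} \<and>
       analytic_curve {A..B} (\<gamma> \<circ> the_inv_into {a..b} S))"
proof -
  note ab = \<open>a < b\<close> and \<Gamma>_eq = assms(5)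
  have \<gamma>_diff: "\<gamma> differentiable (at t within {a..b})" "vector_derivative \<gamma> (at t within {a..b}) \<noteq> 0"
    and \<gamma>_ext: "extends_holomorphically {a..b} \<gamma> t" if "t \<in> {a..b}" for t
    using assms(2) that unfolding analytic_curve_alt_def by blast+
  define f where "f t = Re (F (\<Gamma> t))" for t
  have F_eq: "F (\<Gamma> t) = of_real (f t)" and f_pos: "f t > 0" if "t \<in> {a..b}" for t
    using assms(9) that by (force simp: f_def)+
  have F_ext: "extends_holomorphically {a..b} (\<lambda>t. F (\<Gamma> t)) t" if "t \<in> {a..b}" for t
  proof -
    have "conj_jet e {a..b} \<gamma> ` {a..b} \<subseteq> \<Omega>"
      using assms(7) \<Gamma>_eq by auto
    from extends_holomorphically_jet_functional[OF ab \<gamma>_ext[OF that] that \<open>open \<Omega>\<close> this assms(8)]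
    show ?thesis
      unfolding extends_holomorphically_def using \<Gamma>_eq by auto
  qed
  have "continuous_on {a..b} (\<lambda>t. F (\<Gamma> t))"
    using F_ext by (simp add: continuous_on_eq_continuous_within extends_holomorphically_imp_continuous)
  then have f_cont: "continuous_on {a..b} f"
    unfolding f_def by (intro continuous_intros)
  \<comment> \<open>\<open>S\<close> equals the integral throughout \<open>{a..b}\<close>, so any
    positive radius serves for the transfer; \<open>1\<close> is an arbitrary choice.\<close>
  have dS: "(S has_real_derivative f t) (at t within {a..b})" if "t \<in> {a..b}" for t
    using integral_has_real_derivative[OF f_cont that] that assms(10)
    by (auto simp: f_def[abs_def] elim!: has_field_derivative_transform_within[of _ _ _ _ 1])
  have S_cont: "continuous_on {a..b} S"
    using dS by (rule DERIV_continuous_on)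
  have S_mono: "strict_mono_on {a..b} S"
  proof (rule strict_mono_onI)
    fix s t assume st: "s \<in> {a..b}" "t \<in> {a..b}" "s < t"
    show "S s < S t"
    proof (rule DERIV_pos_imp_increasing_open[OF \<open>s < t\<close>])
      fix u assume u: "s < u" "u < t"
      then show "\<exists>y. DERIV S u :> y \<and> 0 < y"
        using dS[of u] f_pos[of u] st at_within_Icc_at[of a u b] by auto
    qed (use S_cont st in \<open>auto elim: continuous_on_subset\<close>)
  qed
  then have S_inj: "inj_on S {a..b}"
    by (rule strict_mono_on_imp_inj_on)
  have "S a < S b"
    using S_mono ab by (simp add: strict_mono_onD)
  have img: "S ` {a..b} = {S a..S b}"
  proof (intro subset_antisym subsetI)
    fix s assume "s \<in> S ` {a..b}"
    then show "s \<in> {S a..S b}"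
      using strict_mono_on_leD[OF S_mono] ab by auto
  next
    fix s assume "s \<in> {S a..S b}"
    then show "s \<in> S ` {a..b}"
      using IVT'[of S a s b] S_cont ab by force
  qed
  let ?\<delta> = "\<gamma> \<circ> the_inv_into {a..b} S"
  have \<delta>_ext: "extends_holomorphically {S a..S b} ?\<delta> s"
    and \<delta>_diff: "?\<delta> differentiable (at s within {S a..S b})"
    and \<delta>_regular: "vector_derivative ?\<delta> (at s within {S a..S b}) \<noteq> 0"
    if s: "s \<in> {S a..S b}" for s
  proof -
    obtain t where t: "t \<in> {a..b}" "s = S t"
      using s img by blast
    obtain r h where r: "r > 0" and h: "h holomorphic_on ball (of_real t) r"
      and eq: "\<And>u. u \<in> {a..b} \<inter> ball t r \<Longrightarrow> F (\<Gamma> u) = h (of_real u)"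
      using F_ext[OF t(1)] unfolding extends_holomorphically_def by blast
    \<comment> \<open>At real points \<open>h\<close> takes the values of \<open>f\<close>, the
      derivative of \<open>S\<close>. Hence a suitable primitive of \<open>h\<close> extends
      \<open>S\<close>.\<close>
    have "((\<lambda>t. of_real (S t)) has_vector_derivative h (of_real u)) (at u within {a..b})"
      if u: "u \<in> {a..b} \<inter> ball t r" for u
    proof -
      have "h (of_real u) = of_real (f u)"
        using eq[OF u] F_eq u by auto
      then show ?thesis
        using has_vector_derivative_of_real[OF dS] u by auto
    qed
    then obtain H where H: "\<And>z. z \<in> ball (of_real t) r \<Longrightarrow> (H has_field_derivative h z) (at z)"
        "\<And>u. u \<in> {a..b} \<inter> ball t r \<Longrightarrow> of_real (S u) = H (of_real u)"
      using holomorphic_antiderivative_extends[OF convex_real_interval(5) t(1) r h] by blast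
    have "H holomorphic_on ball (of_real t) r"
      using H(1) by (meson holomorphic_on_open open_ball)
    \<comment> \<open>Positivity of \<open>F\<close> on the jet enters here: it makes the primitive
      locally invertible.\<close>
    moreover have "deriv H (of_real t) \<noteq> 0"
    proof -
      have "deriv H (of_real t) = h (of_real t)"
        using r by (intro DERIV_imp_deriv H(1)) simp
      also have "\<dots> = of_real (f t)"
        using eq[of t] F_eq[OF t(1)] r t(1) by simp
      finally show ?thesis
        using f_pos[OF t(1)] by simp
    qed
    ultimately show "extends_holomorphically {S a..S b} ?\<delta> s"
      using extends_holomorphically_reparametrize[OF S_inj S_cont t(1) \<gamma>_ext[OF t(1)] _ r _ H(2)]
      by (simp add: img t(2))
    have T: "the_inv_into {a..b} S (S t) = t" "the_inv_into {a..b} S ` {S a..S b} = {a..b}"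
      using the_inv_into_f_f[OF S_inj t(1)] the_inv_into_onto[OF S_inj] by (simp_all add: img)
    \<comment> \<open>The chain rule gives the derivative of \<gamma> at \<open>t\<close> divided by
      \<open>f t\<close>, which is nonzero because \<gamma> is regular. Uniqueness of the derivative
      within \<open>{S a..S b}\<close> comes from \<open>S a < S b\<close>.\<close>
    have "(?\<delta> has_vector_derivative inverse (f t) *\<^sub>R vector_derivative \<gamma> (at t within {a..b}))
        (at (S t) within {S a..S b})"
    proof (rule vector_diff_chain_within)
      show "(the_inv_into {a..b} S has_vector_derivative inverse (f t)) (at (S t) within {S a..S b})"
        using has_real_derivative_the_inv_into[OF S_inj S_cont t(1) dS[OF t(1)]] f_pos[OF t(1)]
        by (simp add: img has_real_derivative_iff_has_vector_derivative)
    qed (use \<gamma>_diff(1)[OF t(1)] T in \<open>simp add: vector_derivative_works\<close>)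
    then show "?\<delta> differentiable (at s within {S a..S b})"
        "vector_derivative ?\<delta> (at s within {S a..S b}) \<noteq> 0"
      using vector_derivative_within_closed_interval[OF \<open>S a < S b\<close>, of "S t" ?\<delta>] s t f_pos[OF t(1)] \<gamma>_diff(2)[OF t(1)]
      by (auto simp: differentiableI_vector)
  qed
  have "continuous_on {S a..S b} ?\<delta>"
    unfolding continuous_on_eq_continuous_within
    using \<delta>_ext extends_holomorphically_imp_continuous by blast
  then have "analytic_curve {S a..S b} ?\<delta>"
    unfolding analytic_curve_alt_def
    using \<open>S a < S b\<close> \<delta>_ext \<delta>_diff \<delta>_regular by (auto simp: is_interval_cc is_singleton_def)
  then show ?thesis
    using S_mono S_cont img by blast
qed

end
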